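(* Let $Z=z_1e_1+z_2e_2$, $\mathcal{V}=\nu_1e_1+\nu_2e_2=\alpha+j\beta$, $C=c_1e_1+c_2e_2\in\mathbb{BC}$ and let $k\in\mathbb{N}$ be a positive integer. Then $$\frac{d^k}{dZ^k}\left(E_{\mathcal{V},C}(Z)\right)=\sum_{p=1}^{k}\frac{C^{k-p}Z^{\mathcal{V}-p}}{\Gamma(\mathcal{V}-p+1)}+C^kE_{\mathcal{V},C}(Z).$$
   Context: Bicomplex numbers: $\mathbb{BC}=\{w_1+jw_2: w_1,w_2\in\mathbb{C}(i)\}$, where $\mathbb{C}(i)$ is the complex field with unit $i$, $i^2=j^2=-1$, $ij=ji$. Put $e_1=\frac{1+ij}{2}$, $e_2=\frac{1-ij}{2}$, so $e_1+e_2=1$, $e_l^2=e_l$, $e_1e_2=0$. Every $Z=w_1+jw_2$ is uniquely $Z=z_1e_1+z_2e_2$ with $z_1=w_1-iw_2$, $z_2=w_1+iw_2\in\mathbb{C}(i)$, and addition, multiplication and division are componentwise in $e_1,e_2$. Functions act componentwise: $\Gamma(Y)=\Gamma(y_1)e_1+\Gamma(y_2)e_2$ for $Y=y_1e_1+y_2e_2$ (with $1/\Gamma$ equal to $0$ at the poles of $\Gamma$), and $Z^{W}=z_1^{w_1}e_1+z_2^{w_2}e_2$ for $Z=z_1e_1+z_2e_2$, $W=w_1e_1+w_2e_2$ (principal complex powers; usual powers with $0^0=1$ for integer exponents). Identities are understood for $Z$ at which the occurring powers are defined and holomorphic (e.g. $z_1,z_2\notin(-\infty,0]$). Bicomplex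 Miller-Ross function: $E_{\mathcal{V},C}(Z)=Z^{\mathcal{V}}\sum_{r=0}^{\infty}\frac{(CZ)^r}{\Gamma(\mathcal{V}+r+1)}$ for $\mathcal{V},C,Z\in\mathbb{BC}$. Bicomplex derivative: $\frac{df}{dZ}(Z_0)=\lim\frac{f(Z_0+\Delta Z)-f(Z_0)}{\Delta Z}$ as $\Delta Z\to0$ through non-zero-divisors; for $f(Z)=f_1(z_1)e_1+f_2(z_2)e_2$ with $f_1,f_2$ holomorphic it equals $f_1'(z_1)e_1+f_2'(z_2)e_2$. *)

theory Defs
  imports "HOL-Analysis.Analysis"
begin

section \<open>Bicomplex numbers\<close>

text \<open>\<open>Bicomplex w1 w2\<close> stands for $w_1 + j w_2$.\<close>

datatype bicomplex = Bicomplex (bc_w1: complex) (bc_w2: complex)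

lemma bicomplex_eqI: "bc_w1 X = bc_w1 Y \<Longrightarrow> bc_w2 X = bc_w2 Y \<Longrightarrow> X = Y"
  by (rule bicomplex.expand) simp

instantiation bicomplex :: comm_ring_1
begin

definition "0 = Bicomplex 0 0"
definition "1 = Bicomplex 1 0"
definition "X + Y = Bicomplex (bc_w1 X + bc_w1 Y) (bc_w2 X + bc_w2 Y)"
definition "X - Y = Bicomplex (bc_w1 X - bc_w1 Y) (bc_w2 X - bc_w2 Y)"
definition "- X = Bicomplex (- bc_w1 X) (- bc_w2 X)"
definition "X * Y = Bicomplex (bc_w1 X * bc_w1 Y - bc_w2 X * bc_w2 Y)
                              (bc_w1 X * bc_w2 Y + bc_w2 X * bc_w1 Y)"

instance
  by standard
    (auto simp: zero_bicomplex_def one_bicomplex_def plus_bicomplex_def minus_bicomplex_def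
      uminus_bicomplex_def times_bicomplex_def algebra_simps intro!: bicomplex_eqI)

end

lemma bc_w_simps [simp]:
  "bc_w1 0 = 0" "bc_w2 0 = 0" "bc_w1 1 = 1" "bc_w2 1 = 0"
  "bc_w1 (X + Y) = bc_w1 X + bc_w1 Y" "bc_w2 (X + Y) = bc_w2 X + bc_w2 Y"
  "bc_w1 (X - Y) = bc_w1 X - bc_w1 Y" "bc_w2 (X - Y) = bc_w2 X - bc_w2 Y"
  "bc_w1 (- X) = - bc_w1 X" "bc_w2 (- X) = - bc_w2 X"
  "bc_w1 (X * Y) = bc_w1 X * bc_w1 Y - bc_w2 X * bc_w2 Y"
  "bc_w2 (X * Y) = bc_w1 X * bc_w2 Y + bc_w2 X * bc_w1 Y"
  by (simp_all add: zero_bicomplex_def one_bicomplex_def plus_bicomplex_def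
      minus_bicomplex_def uminus_bicomplex_def times_bicomplex_def)

text \<open>The topology is that of the Euclidean norm on $\mathbb{C}^2$.\<close>

instantiation bicomplex :: real_normed_vector
begin

definition "scaleR r X = Bicomplex (scaleR r (bc_w1 X)) (scaleR r (bc_w2 X))"
definition "norm X = norm (bc_w1 X, bc_w2 X)"
definition "sgn X = scaleR (inverse (norm X)) X" for X :: bicomplex
definition "dist X Y = norm (X - Y)" for X Y :: bicomplex
definition "uniformity = (INF e\<in>{0<..}. principal {(X :: bicomplex, Y). dist X Y < e})"
definition "open (U :: bicomplex set) \<longleftrightarrow>
  (\<forall>X\<in>U. eventually (\<lambda>(X', Y). X' = X \<longrightarrow> Y \<in> U) uniformity)"

instance
proof
  fix X Y :: bicomplex and r s :: real and U :: "bicomplex set"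
  show "norm (X + Y) \<le> norm X + norm Y"
    using norm_triangle_ineq[of "(bc_w1 X, bc_w2 X)" "(bc_w1 Y, bc_w2 Y)"]
    by (simp add: norm_bicomplex_def)
  show "norm (scaleR r X) = \<bar>r\<bar> * norm X"
    using norm_scaleR[of r "(bc_w1 X, bc_w2 X)"]
    by (simp add: norm_bicomplex_def scaleR_bicomplex_def)
  show "norm X = 0 \<longleftrightarrow> X = 0"
    by (auto simp: norm_bicomplex_def zero_prod_def intro!: bicomplex_eqI)
qed (auto simp: scaleR_bicomplex_def sgn_bicomplex_def dist_bicomplex_def
      uniformity_bicomplex_def open_bicomplex_def algebra_simps intro!: bicomplex_eqI)

end

section \<open>Idempotent representation\<close>

definition bc_of_complex :: "complex \<Rightarrow> bicomplex" where
  "bc_of_complex w = Bicomplex w 0"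

definition bc_j :: bicomplex where
  "bc_j = Bicomplex 0 1"

definition bc_e1 :: bicomplex where
  "bc_e1 = bc_of_complex (1/2) * (1 + bc_of_complex \<i> * bc_j)"

definition bc_e2 :: bicomplex where
  "bc_e2 = bc_of_complex (1/2) * (1 - bc_of_complex \<i> * bc_j)"

definition bc_z1 :: "bicomplex \<Rightarrow> complex" where
  "bc_z1 Z = bc_w1 Z - \<i> * bc_w2 Z"

definition bc_z2 :: "bicomplex \<Rightarrow> complex" where
  "bc_z2 Z = bc_w1 Z + \<i> * bc_w2 Z"

definition bc_idem :: "complex \<Rightarrow> complex \<Rightarrow> bicomplex" where
  "bc_idem z1 z2 = bc_of_complex z1 * bc_e1 + bc_of_complex z2 * bc_e2"

lemmas bc_coord_defs = bc_of_complex_def bc_j_def bc_e1_def bc_e2_def bc_idem_def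
  bc_z1_def bc_z2_def

lemma bicomplex_decomp: "Z = bc_of_complex (bc_w1 Z) + bc_j * bc_of_complex (bc_w2 Z)"
  by (rule bicomplex_eqI) (simp_all add: bc_coord_defs)

lemma bc_j_squared: "bc_j * bc_j = - 1"
  by (rule bicomplex_eqI) (simp_all add: bc_coord_defs)

lemma bc_idem_decomp: "Z = bc_idem (bc_z1 Z) (bc_z2 Z)"
  by (rule bicomplex_eqI) (simp_all add: bc_coord_defs field_simps)

lemma bc_z_idem [simp]: "bc_z1 (bc_idem a b) = a" "bc_z2 (bc_idem a b) = b"
  by (simp_all add: bc_coord_defs field_simps)

lemma bicomplex_eq_iff_z: "X = Y \<longleftrightarrow> bc_z1 X = bc_z1 Y \<and> bc_z2 X = bc_z2 Y"
  by (metis bc_idem_decomp)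

lemma bc_z_simps [simp]:
  "bc_z1 0 = 0" "bc_z2 0 = 0" "bc_z1 1 = 1" "bc_z2 1 = 1"
  "bc_z1 (X + Y) = bc_z1 X + bc_z1 Y" "bc_z2 (X + Y) = bc_z2 X + bc_z2 Y"
  "bc_z1 (X - Y) = bc_z1 X - bc_z1 Y" "bc_z2 (X - Y) = bc_z2 X - bc_z2 Y"
  "bc_z1 (X * Y) = bc_z1 X * bc_z1 Y" "bc_z2 (X * Y) = bc_z2 X * bc_z2 Y"
  by (simp_all add: bc_z1_def bc_z2_def algebra_simps)

text \<open>Division is componentwise; as in the complex field, it is made total by
  \<open>inverse 0 = 0\<close> in each component.\<close>

instantiation bicomplex :: inverse
begin

definition "inverse Z = bc_idem (inverse (bc_z1 Z)) (inverse (bc_z2 Z))"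
definition "Z div W = Z * inverse W" for Z W :: bicomplex

instance ..

end

section \<open>Gamma function and powers\<close>

definition bc_Gamma :: "bicomplex \<Rightarrow> bicomplex" where
  "bc_Gamma Y = bc_idem (Gamma (bc_z1 Y)) (Gamma (bc_z2 Y))"

text \<open>\<open>Gamma\<close> is \<open>0\<close> at its poles in the library, so the reciprocal below has component
  \<open>0\<close> there.\<close>

lemma bc_inverse_Gamma: "1 / bc_Gamma Y = bc_idem (rGamma (bc_z1 Y)) (rGamma (bc_z2 Y))"
  by (simp add: bicomplex_eq_iff_z divide_bicomplex_def inverse_bicomplex_def bc_Gamma_def
      rGamma_inverse_Gamma)

text \<open>Complex power: the usual one (with $0^0 = 1$) for integer exponents, and the principal
  one otherwise.\<close>

definition cpower :: "complex \<Rightarrow> complex \<Rightarrow> complex" where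
  "cpower z w = (if w \<in> \<int> then z powi \<lfloor>Re w\<rfloor> else z powr w)"

definition bc_powr :: "bicomplex \<Rightarrow> bicomplex \<Rightarrow> bicomplex" where
  "bc_powr Z W = bc_idem (cpower (bc_z1 Z) (bc_z1 W)) (cpower (bc_z2 Z) (bc_z2 W))"

text \<open>The points \<open>z\<close> at which $z^w$ is defined and holomorphic in \<open>z\<close>.\<close>

definition cpower_regular :: "complex \<Rightarrow> complex \<Rightarrow> bool" where
  "cpower_regular z w \<longleftrightarrow> z \<notin> \<real>\<^sub>\<le>\<^sub>0 \<or> (w \<in> \<int> \<and> z \<noteq> 0) \<or> w \<in> \<nat>"

definition bc_powr_regular :: "bicomplex \<Rightarrow> bicomplex \<Rightarrow> bool" where
  "bc_powr_regular Z W \<longleftrightarrow>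
     cpower_regular (bc_z1 Z) (bc_z1 W) \<and> cpower_regular (bc_z2 Z) (bc_z2 W)"

section \<open>The bicomplex Miller-Ross function\<close>

definition bc_miller_ross :: "bicomplex \<Rightarrow> bicomplex \<Rightarrow> bicomplex \<Rightarrow> bicomplex" where
  "bc_miller_ross V C Z =
     bc_powr Z V * (\<Sum>r. (C * Z) ^ r / bc_Gamma (V + of_nat r + 1))"

section \<open>Bicomplex derivative\<close>

definition bc_zero_divisor :: "bicomplex \<Rightarrow> bool" where
  "bc_zero_divisor H \<longleftrightarrow> (\<exists>W. W \<noteq> 0 \<and> H * W = 0)"

text \<open>Division by \<open>H\<close> is genuine division here, since \<open>H\<close> is not a zero divisor.\<close>

lemma bc_inverse_right: "\<not> bc_zero_divisor H \<Longrightarrow> H * inverse H = 1"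
proof -
  assume H: "\<not> bc_zero_divisor H"
  have "bc_z1 H \<noteq> 0"
  proof
    assume "bc_z1 H = 0"
    then have "H * bc_idem 1 0 = 0" "bc_idem 1 0 \<noteq> 0"
      by (simp_all add: bicomplex_eq_iff_z)
    with H show False by (auto simp: bc_zero_divisor_def)
  qed
  moreover have "bc_z2 H \<noteq> 0"
  proof
    assume "bc_z2 H = 0"
    then have "H * bc_idem 0 1 = 0" "bc_idem 0 1 \<noteq> 0"
      by (simp_all add: bicomplex_eq_iff_z)
    with H show False by (auto simp: bc_zero_divisor_def)
  qed
  ultimately show ?thesis
    by (simp add: bicomplex_eq_iff_z inverse_bicomplex_def)
qed

definition has_bc_derivative :: "(bicomplex \<Rightarrow> bicomplex) \<Rightarrow> bicomplex \<Rightarrow> bicomplex \<Rightarrow> bool" where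
  "has_bc_derivative f D Z0 \<longleftrightarrow>
     ((\<lambda>H. (f (Z0 + H) - f Z0) / H) \<longlongrightarrow> D) (at 0 within {H. \<not> bc_zero_divisor H})"

definition bc_differentiable :: "(bicomplex \<Rightarrow> bicomplex) \<Rightarrow> bicomplex \<Rightarrow> bool" where
  "bc_differentiable f Z0 \<longleftrightarrow> (\<exists>D. has_bc_derivative f D Z0)"

definition bc_deriv :: "(bicomplex \<Rightarrow> bicomplex) \<Rightarrow> bicomplex \<Rightarrow> bicomplex" where
  "bc_deriv f Z0 = (SOME D. has_bc_derivative f D Z0)"

end

theory Submission
  imports Defs
begin

text \<open>In the idempotent coordinates everything reduces to the complex function
  $f(z) = z^\nu g(z)$ with $g(z) = \sum_r a_r z^r$, $a_r = c^r / \Gamma(\nu + r + 1)$. The recurrence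
  $(\nu + r + 1)\, a_{r+1} = c\, a_r$ gives
  $f'(z) = z^{\nu-1}/\Gamma(\nu) + c f(z)$, and iterating this identity on the open set of regular
  points yields the formula.\<close>

section \<open>Idempotent coordinates\<close>

lemma bc_z_power [simp]: "bc_z1 (X ^ n) = bc_z1 X ^ n" "bc_z2 (X ^ n) = bc_z2 X ^ n"
  by (induction n) simp_all

lemma bc_z_of_nat [simp]: "bc_z1 (of_nat n) = of_nat n" "bc_z2 (of_nat n) = of_nat n"
  by (induction n) simp_all

lemma bc_z_sum [simp]:
  "bc_z1 (sum f A) = (\<Sum>x\<in>A. bc_z1 (f x))" "bc_z2 (sum f A) = (\<Sum>x\<in>A. bc_z2 (f x))"
  by (induction A rule: infinite_finite_induct) simp_all

lemma bc_z_divide [simp]: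
  "bc_z1 (X / Y) = bc_z1 X / bc_z1 Y" "bc_z2 (X / Y) = bc_z2 X / bc_z2 Y"
  by (simp_all add: divide_bicomplex_def inverse_bicomplex_def field_simps)

lemma bc_z_Gamma [simp]:
  "bc_z1 (bc_Gamma Y) = Gamma (bc_z1 Y)" "bc_z2 (bc_Gamma Y) = Gamma (bc_z2 Y)"
  by (simp_all add: bc_Gamma_def)

lemma bc_z_powr [simp]:
  "bc_z1 (bc_powr Z W) = cpower (bc_z1 Z) (bc_z1 W)"
  "bc_z2 (bc_powr Z W) = cpower (bc_z2 Z) (bc_z2 W)"
  by (simp_all add: bc_powr_def)

text \<open>The idempotents e_1 and e_2 annihilate exactly the elements whose first, respectively
  second, coordinate vanishes; conversely, each coordinate lives in a field.\<close>

lemma bc_zero_divisor_iff: "bc_zero_divisor H \<longleftrightarrow> bc_z1 H = 0 \<or> bc_z2 H = 0"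
proof
  assume "bc_zero_divisor H"
  then show "bc_z1 H = 0 \<or> bc_z2 H = 0"
    by (auto simp: bc_zero_divisor_def bicomplex_eq_iff_z)
next
  assume "bc_z1 H = 0 \<or> bc_z2 H = 0"
  moreover have "H * bc_idem 1 0 = 0 \<and> bc_idem 1 0 \<noteq> 0" if "bc_z1 H = 0"
    using that by (simp add: bicomplex_eq_iff_z)
  moreover have "H * bc_idem 0 1 = 0 \<and> bc_idem 0 1 \<noteq> 0" if "bc_z2 H = 0"
    using that by (simp add: bicomplex_eq_iff_z)
  ultimately show "bc_zero_divisor H"
    unfolding bc_zero_divisor_def by blast
qed

section \<open>Norm, limits and series in coordinates\<close>

lemma norm_bc_w_le: "norm (bc_w1 X) \<le> norm X" "norm (bc_w2 X) \<le> norm X"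
  using norm_fst_le[of "bc_w1 X" "bc_w2 X"] norm_snd_le[of "bc_w2 X" "bc_w1 X"]
  by (simp_all add: norm_bicomplex_def)

lemma norm_bc_le: "norm X \<le> norm (bc_w1 X) + norm (bc_w2 X)"
  using norm_Pair_le[of "bc_w1 X" "bc_w2 X"] by (simp add: norm_bicomplex_def)

lemma bounded_linear_bc_w1: "bounded_linear bc_w1"
  by (rule bounded_linear_intro[where K = 1]) (simp_all add: scaleR_bicomplex_def norm_bc_w_le)

lemma bounded_linear_bc_w2: "bounded_linear bc_w2"
  by (rule bounded_linear_intro[where K = 1]) (simp_all add: scaleR_bicomplex_def norm_bc_w_le)

lemma bounded_linear_bc_z1: "bounded_linear bc_z1"
  unfolding bc_z1_def
  by (intro bounded_linear_sub bounded_linear_const_mult bounded_linear_bc_w1 bounded_linear_bc_w2)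

lemma bounded_linear_bc_z2: "bounded_linear bc_z2"
  unfolding bc_z2_def
  by (intro bounded_linear_add bounded_linear_const_mult bounded_linear_bc_w1 bounded_linear_bc_w2)

lemma tendsto_bc_w:
  assumes "((\<lambda>x. bc_w1 (f x)) \<longlongrightarrow> bc_w1 L) F" "((\<lambda>x. bc_w2 (f x)) \<longlongrightarrow> bc_w2 L) F"
  shows "(f \<longlongrightarrow> L) F"
proof -
  have "((\<lambda>x. norm (bc_w1 (f x) - bc_w1 L) + norm (bc_w2 (f x) - bc_w2 L)) \<longlongrightarrow> 0) F"
    using tendsto_add[OF tendsto_norm_zero tendsto_norm_zero, OF
        assms(1)[THEN LIM_zero] assms(2)[THEN LIM_zero]] by simp
  then have "((\<lambda>x. f x - L) \<longlongrightarrow> 0) F"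
    by (rule Lim_null_comparison[rotated]) (use norm_bc_le[of "f _ - L"] in simp)
  then show ?thesis by (rule LIM_zero_cancel)
qed

lemma tendsto_bc_z:
  assumes "((\<lambda>x. bc_z1 (f x)) \<longlongrightarrow> bc_z1 L) F" "((\<lambda>x. bc_z2 (f x)) \<longlongrightarrow> bc_z2 L) F"
  shows "(f \<longlongrightarrow> L) F"
proof (rule tendsto_bc_w)
  \<comment> \<open>The inverse change of coordinates is linear, so limits of the idempotent
    coordinates determine those of the Cartesian ones.\<close>
  have w: "bc_w1 X = (bc_z1 X + bc_z2 X) / 2" "bc_w2 X = (bc_z2 X - bc_z1 X) / (2 * \<i>)" for X
    by (simp_all add: bc_z1_def bc_z2_def)
  show "((\<lambda>x. bc_w1 (f x)) \<longlongrightarrow> bc_w1 L) F" "((\<lambda>x. bc_w2 (f x)) \<longlongrightarrow> bc_w2 L) F"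
    unfolding w by (intro tendsto_intros assms; simp)+
qed

lemma bc_suminf:
  assumes "(\<lambda>r. bc_z1 (f r)) sums a" "(\<lambda>r. bc_z2 (f r)) sums b"
  shows "suminf f = bc_idem a b"
proof -
  have "f sums bc_idem a b"
    using assms unfolding sums_def by (intro tendsto_bc_z) simp_all
  then show ?thesis by (rule sums_unique[symmetric])
qed

section \<open>The bicomplex derivative in idempotent coordinates\<close>

text \<open>Avoiding zero divisors keeps both coordinates of the increment nonzero, so complex
  difference quotients can be composed with the projections.\<close>

lemma filterlim_bc_z_regular:
  "filterlim bc_z1 (at 0) (at 0 within {H. \<not> bc_zero_divisor H})"
  "filterlim bc_z2 (at 0) (at 0 within {H. \<not> bc_zero_divisor H})"
proof -
  have "(bc_z1 \<longlongrightarrow> 0) (at 0 within {H. \<not> bc_zero_divisor H})"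
    "(bc_z2 \<longlongrightarrow> 0) (at 0 within {H. \<not> bc_zero_divisor H})"
    using bounded_linear.tendsto[OF bounded_linear_bc_z1 tendsto_ident_at, of 0]
      bounded_linear.tendsto[OF bounded_linear_bc_z2 tendsto_ident_at, of 0] by simp_all
  then show "filterlim bc_z1 (at 0) (at 0 within {H. \<not> bc_zero_divisor H})"
    "filterlim bc_z2 (at 0) (at 0 within {H. \<not> bc_zero_divisor H})"
    by (auto simp: filterlim_at eventually_at_filter bc_zero_divisor_iff)
qed

text \<open>This makes bicomplex derivatives unique. Small positive reals are witnesses: both
  idempotent coordinates equal the real itself.\<close>

lemma at_regular_neq_bot: "at (0 :: bicomplex) within {H. \<not> bc_zero_divisor H} \<noteq> bot"
proof -
  have "\<exists>H\<in>{H. \<not> bc_zero_divisor H}. H \<noteq> 0 \<and> dist H 0 < e" if "e > 0" for e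
  proof
    define H where "H = Bicomplex (of_real (e / 2)) 0"
    have "norm H \<le> e / 2"
      using norm_bc_le[of H] that by (simp add: H_def)
    moreover have "H \<noteq> 0"
      using that by (simp add: H_def zero_bicomplex_def)
    ultimately show "H \<noteq> 0 \<and> dist H 0 < e"
      using that by (simp add: dist_bicomplex_def)
    show "H \<in> {H. \<not> bc_zero_divisor H}"
      using that by (simp add: bc_zero_divisor_iff H_def bc_z1_def bc_z2_def)
  qed
  then show ?thesis
    by (simp add: trivial_limit_within islimpt_approachable)
qed

lemma bc_deriv_eqI:
  assumes "has_bc_derivative f D Z0"
  shows "bc_deriv f Z0 = D"
proof -
  have "has_bc_derivative f (bc_deriv f Z0) Z0"
    unfolding bc_deriv_def using assms by (rule someI)
  with assms show ?thesis
    unfolding has_bc_derivative_def using tendsto_unique[OF at_regular_neq_bot] by blast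
qed

text \<open>The difference quotient splits into two complex ones. Agreement on a neighbourhood
  \<open>S\<close> suffices, which is what iterated derivatives offer: their closed form is known
  only at regular points.\<close>

lemma has_bc_derivative_idem:
  assumes f1: "(f1 has_field_derivative d1) (at (bc_z1 Z0))"
    and f2: "(f2 has_field_derivative d2) (at (bc_z2 Z0))"
    and "open S" "Z0 \<in> S"
    and f: "\<And>Z. Z \<in> S \<Longrightarrow> f Z = bc_idem (f1 (bc_z1 Z)) (f2 (bc_z2 Z))"
  shows "has_bc_derivative f (bc_idem d1 d2) Z0"
proof -
  let ?F = "at 0 within {H. \<not> bc_zero_divisor H}"
  let ?g = "\<lambda>H. bc_idem ((f1 (bc_z1 Z0 + bc_z1 H) - f1 (bc_z1 Z0)) / bc_z1 H)
      ((f2 (bc_z2 Z0 + bc_z2 H) - f2 (bc_z2 Z0)) / bc_z2 H)"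
  have "((\<lambda>H. (f1 (bc_z1 Z0 + bc_z1 H) - f1 (bc_z1 Z0)) / bc_z1 H) \<longlongrightarrow> d1) ?F"
    using filterlim_compose[OF f1[unfolded DERIV_def] filterlim_bc_z_regular(1)] .
  moreover have "((\<lambda>H. (f2 (bc_z2 Z0 + bc_z2 H) - f2 (bc_z2 Z0)) / bc_z2 H) \<longlongrightarrow> d2) ?F"
    using filterlim_compose[OF f2[unfolded DERIV_def] filterlim_bc_z_regular(2)] .
  ultimately have "(?g \<longlongrightarrow> bc_idem d1 d2) ?F"
    by (intro tendsto_bc_z) simp_all
  moreover have "((\<lambda>H. Z0 + H) \<longlongrightarrow> Z0) ?F"
    using tendsto_add[OF tendsto_const tendsto_ident_at, of Z0 0] by simp
  then have "\<forall>\<^sub>F H in ?F. Z0 + H \<in> S"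
    using assms(3,4) by (rule topological_tendstoD)
  then have "\<forall>\<^sub>F H in ?F. ?g H = (f (Z0 + H) - f Z0) / H"
    by eventually_elim (simp add: f \<open>Z0 \<in> S\<close> bicomplex_eq_iff_z)
  ultimately show ?thesis
    unfolding has_bc_derivative_def by (rule Lim_transform_eventually)
qed

section \<open>Complex powers\<close>

lemma cpower_of_nat [simp]: "cpower z (of_nat n) = z ^ n"
  by (simp add: cpower_def)

text \<open>Exponent 0 is excluded because of the base 0: there 0^0 = 1, while the right-hand side
  is 0.\<close>

lemma cpower_rec:
  assumes "w \<noteq> 0"
  shows "cpower z w = z * cpower z (w - 1)"
proof (cases "w \<in> \<int>")
  case True
  then obtain n where n: "w = of_int n" by (auto elim: Ints_cases)
  then have w1: "w - 1 = of_int (n - 1)" by simp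
  have "z powi n = z * z powi (n - 1)"
    using assms n power_int_add[of z 1 "n - 1"]
    by (cases "z = 0") (auto simp: power_int_0_left_if)
  then show ?thesis
    unfolding cpower_def w1 unfolding n by simp
next
  case False
  then have "w - 1 \<notin> \<int>"
    using Ints_add[of "w - 1" 1] by auto
  with False show ?thesis
    by (cases "z = 0") (simp_all add: cpower_def powr_diff)
qed

lemma open_cpower_regular: "open {z. cpower_regular z w}"
proof -
  \<comment> \<open>The cases are natural, negative integer and non-integer exponents.\<close>
  have "{z. cpower_regular z w} = UNIV \<or> {z. cpower_regular z w} = - {0} \<or>
      {z. cpower_regular z w} = - \<real>\<^sub>\<le>\<^sub>0"
    by (auto simp: cpower_regular_def)
  then show ?thesis
    by (elim disjE) (simp_all add: open_Compl)
qed

lemma cpower_has_field_derivative: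
  assumes "cpower_regular z w"
  shows "((\<lambda>z. cpower z w) has_field_derivative w * cpower z (w - 1)) (at z)"
proof (cases "w \<in> \<int>")
  case True
  then obtain n where n: "w = of_int n" by (auto elim: Ints_cases)
  then have w1: "w - 1 = of_int (n - 1)" by simp
  show ?thesis
  proof (cases "z = 0")
    case False
    then show ?thesis
      unfolding cpower_def w1 unfolding n
      by (auto intro!: derivative_eq_intros)
  next
    case True
    with assms obtain m where m: "w = of_nat m"
      by (auto simp: cpower_regular_def Nats_def)
    \<comment> \<open>For \<open>m = 0\<close> the exponents -1 and \<open>m - 1 = 0\<close> differ,
      but the factor \<open>of_nat m\<close> vanishes.\<close>
    have deriv: "of_nat m * cpower z (of_nat m - 1) = of_nat m * z ^ (m - 1)"
      by (cases m) simp_all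
    show ?thesis
      unfolding m cpower_of_nat deriv using DERIV_power[OF DERIV_ident, of m z] by simp
  qed
next
  case False
  then have "w - 1 \<notin> \<int>"
    using Ints_add[of "w - 1" 1] by auto
  moreover have "z \<notin> \<real>\<^sub>\<le>\<^sub>0"
    using False assms Nats_subset_Ints by (auto simp: cpower_regular_def)
  ultimately show ?thesis
    using False has_field_derivative_powr[of z w] by (simp add: cpower_def)
qed

section \<open>The complex Miller-Ross function\<close>

text \<open>The reciprocal Gamma function is entire, so its functional equation holds without
  exceptional values of \<open>v\<close>.\<close>

definition mr_coeff :: "complex \<Rightarrow> complex \<Rightarrow> nat \<Rightarrow> complex" where
  "mr_coeff v c r = c ^ r * rGamma (v + of_nat r + 1)"

definition miller_ross :: "complex \<Rightarrow> complex \<Rightarrow> complex \<Rightarrow> complex" where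
  "miller_ross v c z = cpower z v * (\<Sum>r. mr_coeff v c r * z ^ r)"

lemma mr_coeff_rec: "(v + of_nat r + 1) * mr_coeff v c (Suc r) = c * mr_coeff v c r"
  using rGamma_plus1[of "v + of_nat r + 1"]
  by (simp add: mr_coeff_def add_ac)

text \<open>This boundary case of the recurrence produces the extra power term in the first
  derivative.\<close>

lemma mr_coeff_0: "v * mr_coeff v c 0 = rGamma v"
  using rGamma_plus1[of v] by (simp add: mr_coeff_def)

lemma summable_mr_coeff: "summable (\<lambda>r. mr_coeff v c r * z ^ r)"
proof -
  \<comment> \<open>For n >= N, |v + n + 1| >= n + 1 - |v| > 2 |c z|, so successive terms shrink at
    least by the factor 1/2.\<close>
  obtain N where N: "2 * norm (c * z) + norm v < of_nat N"
    using reals_Archimedean2 by blast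
  have "norm (mr_coeff v c (Suc n) * z ^ Suc n) \<le> 1/2 * norm (mr_coeff v c n * z ^ n)"
    if "n \<ge> N" for n
  proof -
    let ?s = "v + of_nat n + 1"
    have "norm (of_nat (Suc n) :: complex) \<le> norm ?s + norm v"
      using norm_triangle_ineq4[of ?s v] by (simp add: add_ac)
    then have "2 * norm (c * z) \<le> norm ?s" "norm ?s > 0"
      using N that norm_ge_zero[of "c * z"] unfolding norm_of_nat by linarith+
    have "norm ?s * norm (mr_coeff v c (Suc n) * z ^ Suc n) =
        norm (?s * mr_coeff v c (Suc n) * (z * z ^ n))"
      by (simp add: norm_mult mult_ac)
    also have "\<dots> = norm (c * z) * norm (mr_coeff v c n * z ^ n)"
      unfolding mr_coeff_rec by (simp add: norm_mult mult_ac)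
    also have "\<dots> \<le> (norm ?s / 2) * norm (mr_coeff v c n * z ^ n)"
      using \<open>2 * norm (c * z) \<le> norm ?s\<close> by (intro mult_right_mono) auto
    finally have "norm ?s * norm (mr_coeff v c (Suc n) * z ^ Suc n) \<le>
        norm ?s * (1/2 * norm (mr_coeff v c n * z ^ n))" by simp
    with \<open>norm ?s > 0\<close> show ?thesis by (simp only: mult_le_cancel_left_pos)
  qed
  then show ?thesis
    by (intro summable_ratio_test[of "1/2" N]) auto
qed

text \<open>The derivative is valid also at \<open>z = 0\<close>, \<open>v = 0\<close>: there \<open>cpower z (v - 1)\<close>
  has the junk value \<open>0\<close>, but its factor \<open>rGamma v\<close> vanishes anyway.\<close>

lemma miller_ross_has_field_derivative:
  assumes "cpower_regular z v"
  shows "(miller_ross v c has_field_derivative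
    cpower z (v - 1) * rGamma v + c * miller_ross v c z) (at z)"
proof -
  define a where "a = mr_coeff v c"
  define g where "g z = (\<Sum>r. a r * z ^ r)" for z
  define h where "h = (\<Sum>r. a (Suc r) * z ^ r)"
  have summ: "summable (\<lambda>r. a r * z ^ r)" for z
    unfolding a_def by (rule summable_mr_coeff)
  have "summable (\<lambda>r. a (Suc r) * z ^ r)"
    using summ[of z] by (rule summable_powser_split_head[THEN iffD2])
  then have h: "(\<lambda>r. a (Suc r) * z ^ r) sums h"
    unfolding h_def by (rule summable_sums)
  have g: "(\<lambda>r. a r * z ^ r) sums g z"
    unfolding g_def using summ by (rule summable_sums)
  \<comment> \<open>The recurrence, solved for (r + 1) a_{r+1}, turns the termwise derivative into
    g' = c g - v h. Here h stands for (g - a_0) / z without dividing by z.\<close>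
  have diffs: "diffs a r = c * a r - v * a (Suc r)" for r
    using mr_coeff_rec[of v r c] by (simp add: diffs_def a_def algebra_simps)
  have "(\<lambda>r. diffs a r * z ^ r) sums (c * g z - v * h)"
    using sums_diff[OF sums_mult[OF g, of c] sums_mult[OF h, of v]]
    by (simp add: diffs algebra_simps)
  then have g': "(g has_field_derivative c * g z - v * h) (at z)"
    using termdiffs_strong_converges_everywhere[OF summ, of z]
    unfolding g_def[abs_def] by (simp add: sums_iff)
  have gh: "g z = a 0 + z * h"
    using powser_split_head(1)[OF summ[of z]] by (simp add: g_def h_def mult.commute)
  \<comment> \<open>The factor \<open>v\<close> covers the case \<open>v = 0\<close>, where
    \<open>cpower_rec\<close> does not apply.\<close>
  have vz: "v * cpower z v = v * (z * cpower z (v - 1))"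
    using cpower_rec[of v z] by (cases "v = 0") simp_all
  have va: "v * a 0 = rGamma v"
    unfolding a_def by (rule mr_coeff_0)
  \<comment> \<open>Product rule with g = a_0 + z h in its first summand; the terms containing h
    cancel by \<open>vz\<close>.\<close>
  have "v * cpower z (v - 1) * g z + (c * g z - v * h) * cpower z v =
      cpower z (v - 1) * (v * a 0) + c * (cpower z v * g z) +
      h * (v * (z * cpower z (v - 1)) - v * cpower z v)"
    by (subst gh) (simp add: algebra_simps)
  also have "\<dots> = cpower z (v - 1) * rGamma v + c * (cpower z v * g z)"
    by (simp add: vz va)
  finally have "((\<lambda>z. cpower z v * g z) has_field_derivative
      cpower z (v - 1) * rGamma v + c * (cpower z v * g z)) (at z)"
    using DERIV_mult[OF cpower_has_field_derivative[OF assms] g'] by simp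
  then show ?thesis
    by (simp add: miller_ross_def[abs_def] g_def a_def)
qed

text \<open>The claimed m-th derivative in one coordinate. The index is one lower than in the final
  formula, so \<open>m = 0\<close> gives an empty sum.\<close>

definition miller_ross_deriv :: "nat \<Rightarrow> complex \<Rightarrow> complex \<Rightarrow> complex \<Rightarrow> complex" where
  "miller_ross_deriv m v c z =
     (\<Sum>p<m. c ^ (m - Suc p) * cpower z (v - of_nat (Suc p)) * rGamma (v - of_nat p))
     + c ^ m * miller_ross v c z"

text \<open>Differentiation moves the summand with index p to index p + 1, and the Miller-Ross term
  supplies the new summand with index 0.\<close>

lemma miller_ross_deriv_has_field_derivative:
  assumes "\<And>p. p \<le> m \<Longrightarrow> cpower_regular z (v - of_nat p)"
  shows "(miller_ross_deriv m v c has_field_derivative miller_ross_deriv (Suc m) v c z) (at z)"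
proof -
  have deriv_term: "((\<lambda>z. c ^ (m - Suc p) * cpower z (v - of_nat (Suc p)) * rGamma (v - of_nat p))
      has_field_derivative
      c ^ (m - Suc p) * cpower z (v - of_nat (Suc (Suc p))) * rGamma (v - of_nat (Suc p))) (at z)"
    if "p < m" for p
  proof -
    let ?w = "v - of_nat (Suc p)"
    have "cpower_regular z ?w"
      using that assms[of "Suc p"] by simp
    from DERIV_cmult_right[OF DERIV_cmult[OF cpower_has_field_derivative[OF this]]]
    have "((\<lambda>z. c ^ (m - Suc p) * cpower z ?w * rGamma (v - of_nat p)) has_field_derivative
        c ^ (m - Suc p) * (?w * cpower z (?w - 1)) * rGamma (v - of_nat p)) (at z)" .
    \<comment> \<open>The functional equation absorbs the exponent brought down by the power
      rule.\<close>
    moreover have "?w * rGamma (v - of_nat p) = rGamma ?w"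
      using rGamma_plus1[of ?w] by simp
    then have "c ^ (m - Suc p) * (?w * cpower z (?w - 1)) * rGamma (v - of_nat p) =
        c ^ (m - Suc p) * cpower z (?w - 1) * rGamma ?w"
      by (metis mult.assoc mult.commute)
    moreover have "?w - 1 = v - of_nat (Suc (Suc p))"
      by simp
    ultimately show ?thesis
      by (simp only:)
  qed
  have "((\<lambda>z. c ^ m * miller_ross v c z) has_field_derivative
      c ^ m * (cpower z (v - 1) * rGamma v + c * miller_ross v c z)) (at z)"
    using assms[of 0] by (intro DERIV_cmult miller_ross_has_field_derivative) simp
  then have
    "(miller_ross_deriv m v c has_field_derivative
      (\<Sum>p<m. c ^ (m - Suc p) * cpower z (v - of_nat (Suc (Suc p))) * rGamma (v - of_nat (Suc p)))
      + c ^ m * (cpower z (v - 1) * rGamma v + c * miller_ross v c z)) (at z)"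
    unfolding miller_ross_deriv_def[abs_def]
    by (intro DERIV_add DERIV_sum deriv_term) simp_all
  moreover have "miller_ross_deriv (Suc m) v c z =
      (\<Sum>p<m. c ^ (m - Suc p) * cpower z (v - of_nat (Suc (Suc p))) * rGamma (v - of_nat (Suc p)))
      + c ^ m * (cpower z (v - 1) * rGamma v + c * miller_ross v c z)"
    unfolding miller_ross_deriv_def sum.lessThan_Suc_shift
    by (simp add: algebra_simps sum_distrib_left)
  ultimately show ?thesis by simp
qed

section \<open>The bicomplex Miller-Ross function\<close>

lemma bc_miller_ross_idem:
  "bc_miller_ross V C Z =
    bc_idem (miller_ross (bc_z1 V) (bc_z1 C) (bc_z1 Z)) (miller_ross (bc_z2 V) (bc_z2 C) (bc_z2 Z))"
proof -
  \<comment> \<open>At a pole \<open>Gamma\<close> is 0 and division by 0 gives 0, which agrees with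
    \<open>rGamma\<close>.\<close>
  have *: "(c * z) ^ r / Gamma (v + of_nat r + 1) = mr_coeff v c r * z ^ r" for c z v :: complex and r
    by (simp add: mr_coeff_def rGamma_inverse_Gamma field_simps power_mult_distrib)
  have "(\<Sum>r. (C * Z) ^ r / bc_Gamma (V + of_nat r + 1)) =
      bc_idem (\<Sum>r. mr_coeff (bc_z1 V) (bc_z1 C) r * bc_z1 Z ^ r)
        (\<Sum>r. mr_coeff (bc_z2 V) (bc_z2 C) r * bc_z2 Z ^ r)"
    by (rule bc_suminf) (simp_all add: * summable_sums summable_mr_coeff)
  then show ?thesis
    by (simp add: bc_miller_ross_def miller_ross_def bicomplex_eq_iff_z)
qed

lemma open_bc_powr_regular: "open {Z. bc_powr_regular Z W}"
proof -
  have "open (bc_z1 -` {z. cpower_regular z (bc_z1 W)} \<inter> bc_z2 -` {z. cpower_regular z (bc_z2 W)})"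
    by (intro open_Int continuous_open_vimage open_cpower_regular
        linear_continuous_at bounded_linear_bc_z1 bounded_linear_bc_z2)
  then show ?thesis
    by (simp add: bc_powr_regular_def vimage_def Int_def)
qed

text \<open>The differentiation step is stated for any \<open>f\<close> with the closed form at
  regular points, so it serves both the induction and the differentiability claim. Finitely many
  regularity conditions define an open set.\<close>

lemma has_bc_derivative_miller_ross:
  assumes eq: "\<And>Y. (\<And>p. p < m \<Longrightarrow> bc_powr_regular Y (V - of_nat p)) \<Longrightarrow>
      f Y = bc_idem (miller_ross_deriv m (bc_z1 V) (bc_z1 C) (bc_z1 Y))
        (miller_ross_deriv m (bc_z2 V) (bc_z2 C) (bc_z2 Y))"
    and reg: "\<And>p. p \<le> m \<Longrightarrow> bc_powr_regular Z (V - of_nat p)"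
  shows "has_bc_derivative f
    (bc_idem (miller_ross_deriv (Suc m) (bc_z1 V) (bc_z1 C) (bc_z1 Z))
      (miller_ross_deriv (Suc m) (bc_z2 V) (bc_z2 C) (bc_z2 Z))) Z"
proof (rule has_bc_derivative_idem)
  let ?S = "\<Inter>p\<in>{..<m}. {Y. bc_powr_regular Y (V - of_nat p)}"
  show "open ?S" by (intro open_INT ballI open_bc_powr_regular finite_lessThan)
  show "Z \<in> ?S" using reg by simp
  show "f Y = bc_idem (miller_ross_deriv m (bc_z1 V) (bc_z1 C) (bc_z1 Y))
      (miller_ross_deriv m (bc_z2 V) (bc_z2 C) (bc_z2 Y))" if "Y \<in> ?S" for Y
    using that by (intro eq) simp
qed (use reg in \<open>auto intro!: miller_ross_deriv_has_field_derivative
    simp: bc_powr_regular_def\<close>)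

text \<open>The induction generalises over \<open>Z\<close>, since differentiating once more at a
  point requires the closed form at neighbouring points.\<close>

lemma bc_deriv_miller_ross:
  assumes "\<And>p. p < m \<Longrightarrow> bc_powr_regular Z (V - of_nat p)"
  shows "(bc_deriv ^^ m) (bc_miller_ross V C) Z =
      bc_idem (miller_ross_deriv m (bc_z1 V) (bc_z1 C) (bc_z1 Z))
        (miller_ross_deriv m (bc_z2 V) (bc_z2 C) (bc_z2 Z))"
  using assms
proof (induction m arbitrary: Z)
  case 0
  show ?case by (simp add: bc_miller_ross_idem miller_ross_deriv_def)
next
  case (Suc m)
  have "has_bc_derivative ((bc_deriv ^^ m) (bc_miller_ross V C))
    (bc_idem (miller_ross_deriv (Suc m) (bc_z1 V) (bc_z1 C) (bc_z1 Z))
      (miller_ross_deriv (Suc m) (bc_z2 V) (bc_z2 C) (bc_z2 Z))) Z"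
    by (rule has_bc_derivative_miller_ross) (use Suc in auto)
  then show ?case by (simp add: bc_deriv_eqI)
qed

theorem theorem4p1:
  fixes V C Z :: bicomplex and k :: nat
  assumes "k \<ge> 1"
    and "\<And>p. p \<le> k \<Longrightarrow> bc_powr_regular Z (V - of_nat p)"
  shows "(\<forall>m<k. bc_differentiable ((bc_deriv ^^ m) (bc_miller_ross V C)) Z) \<and>
    (bc_deriv ^^ k) (bc_miller_ross V C) Z =
      (\<Sum>p=1..k. C ^ (k - p) * bc_powr Z (V - of_nat p) / bc_Gamma (V - of_nat p + 1))
      + C ^ k * bc_miller_ross V C Z"
proof
  show "\<forall>m<k. bc_differentiable ((bc_deriv ^^ m) (bc_miller_ross V C)) Z"
    unfolding bc_differentiable_def
    using has_bc_derivative_miller_ross[OF bc_deriv_miller_ross] assms(2)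
    by (metis (no_types, lifting) le_trans less_imp_le_nat)
  \<comment> \<open>Lowering the index by one turns v - p + 1 into v - p, matching
    \<open>miller_ross_deriv\<close>.\<close>
  have "(\<Sum>p=1..k. c ^ (k - p) * cpower z (v - of_nat p) / Gamma (v - of_nat p + 1)) =
      (\<Sum>p<k. c ^ (k - Suc p) * cpower z (v - of_nat (Suc p)) * rGamma (v - of_nat p))" for c z v
    by (simp add: sum.atLeast1_atMost_eq rGamma_inverse_Gamma divide_inverse)
  then show "(bc_deriv ^^ k) (bc_miller_ross V C) Z =
      (\<Sum>p=1..k. C ^ (k - p) * bc_powr Z (V - of_nat p) / bc_Gamma (V - of_nat p + 1))
      + C ^ k * bc_miller_ross V C Z"
    using assms(2)
    by (simp add: bc_deriv_miller_ross bicomplex_eq_iff_z bc_miller_ross_idem miller_ross_deriv_def)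
qed

end
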